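(* The Cesàro summation method fulfills none of the three properties associativity, commutativity and dilution. That is, Cesàro summation does not have the associativity property, does not have the commutativity property, and does not have the dilution property.
   Context: For a real sequence $(a_0,a_1,a_2,\dots)$ put $S_k=\sum_{j=0}^{k}a_j$ and $Z_n=\frac1n\sum_{k=0}^{n-1}S_k$ for $n\ge 1$. The Cesàro sum of the series $\sum_n a_n$ is $\lim_{n\to\infty}Z_n$, when this limit exists (as a finite or infinite value). A summation method has the - associativity property if, whenever a series with terms $(a_n)_{n\ge 0}$ has a sum by the method, every series obtained from it by replacing, for some or all nonnegative integers $k$, the two consecutive terms $a_{2k},a_{2k+1}$ by the single term $a_{2k}+a_{2k+1}$ has the same sum by the method; - commutativity property if, whenever a series with terms $(a_n)_{n\ge 0}$ has a sum by the method, every series obtained from it by interchanging $a_{2k}$ and $a_{2k+1}$ for some or all nonnegative integers $k$ has the same sum by the method; - dilution property if, whenever a series with terms $(a_n)_{n\ge 0}$ has a sum by the method, every series obtained from it by inserting a single zero between $a_n$ and $a_{n+1}$ for some or all nonnegative integers $n$ has the same sum by the method. *)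

theory Defs
  imports "HOL-Analysis.Analysis"
begin

text \<open>A summation method is a relation: \<open>M a s\<close> means that the series with terms
  \<open>a 0, a 1, \<dots>\<close> has the (finite or infinite) sum \<open>s\<close> by \<open>M\<close>.\<close>

type_synonym summation_method = "(nat \<Rightarrow> real) \<Rightarrow> ereal \<Rightarrow> bool"

definition partial_sum :: "(nat \<Rightarrow> real) \<Rightarrow> nat \<Rightarrow> real" where
  "partial_sum a k = (\<Sum>j\<le>k. a j)"

text \<open>The mean is only meaningful for \<open>n \<ge> 1\<close>; the value \<open>0\<close> at \<open>n = 0\<close> does not affect the limit.\<close>

definition cesaro_mean :: "(nat \<Rightarrow> real) \<Rightarrow> nat \<Rightarrow> real" where
  "cesaro_mean a n = (1 / real n) * (\<Sum>k<n. partial_sum a k)"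

definition cesaro_sums :: summation_method where
  "cesaro_sums a s \<longleftrightarrow> (\<lambda>n. ereal (cesaro_mean a n)) \<longlonglongrightarrow> s"

text \<open>For \<open>k \<in> K\<close> the terms \<open>2k\<close> and \<open>2k+1\<close> are merged. A term of the new series is identified
  by the index at which it starts in the old one, so exactly the indices \<open>2k+1\<close> with
  \<open>k \<in> K\<close> are dropped, and the remaining ones are numbered consecutively by \<^const>\<open>enumerate\<close>.\<close>

definition group_starts :: "nat set \<Rightarrow> nat set" where
  "group_starts K = - {2 * k + 1 | k. k \<in> K}"

definition group_pairs :: "nat set \<Rightarrow> (nat \<Rightarrow> real) \<Rightarrow> nat \<Rightarrow> real" where
  "group_pairs K a m =
     (let i = enumerate (group_starts K) m
      in if even i \<and> i div 2 \<in> K then a i + a (i + 1) else a i)"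

definition swap_pairs :: "nat set \<Rightarrow> (nat \<Rightarrow> real) \<Rightarrow> nat \<Rightarrow> real" where
  "swap_pairs K a i =
     (if i div 2 \<in> K then (if even i then a (i + 1) else a (i - 1)) else a i)"

text \<open>A zero is inserted right after \<open>a n\<close> for each \<open>n \<in> N\<close>, so \<open>a n\<close> is shifted to the right
  by the number of zeros inserted before it; the places not hit by this shift are the zeros.\<close>

definition diluted_index :: "nat set \<Rightarrow> nat \<Rightarrow> nat" where
  "diluted_index N n = n + card {j \<in> N. j < n}"

definition dilute :: "nat set \<Rightarrow> (nat \<Rightarrow> real) \<Rightarrow> nat \<Rightarrow> real" where
  "dilute N a m =
     (if m \<in> range (diluted_index N) then a (inv (diluted_index N) m) else 0)"

definition associativity_property :: "summation_method \<Rightarrow> bool" where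
  "associativity_property M \<longleftrightarrow> (\<forall>a s K. M a s \<longrightarrow> M (group_pairs K a) s)"

definition commutativity_property :: "summation_method \<Rightarrow> bool" where
  "commutativity_property M \<longleftrightarrow> (\<forall>a s K. M a s \<longrightarrow> M (swap_pairs K a) s)"

definition dilution_property :: "summation_method \<Rightarrow> bool" where
  "dilution_property M \<longleftrightarrow> (\<forall>a s N. M a s \<longrightarrow> M (dilute N a) s)"

end

theory Submission
  imports Defs
begin

text \<open>A series whose terms are periodic and add up to zero over a period has periodic partial sums,
  so its Cesaro sum is the average of the partial sums over one period. Grandi's series
  \<open>1 - 1 + 1 - 1 + \<dots>\<close> thus has sum \<open>1/2\<close>. Merging all pairs turns it into the zero series
  (sum \<open>0\<close>), swapping all pairs into its negative (sum \<open>-1/2\<close>), and inserting a zero after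
  every positive term into \<open>1 + 0 - 1 + 1 + 0 - 1 + \<dots>\<close> (sum \<open>2/3\<close>).\<close>

text \<open>Raising \<open>n\<close> by one adds the equal terms \<open>f (n + p)\<close> and
  \<open>f n\<close> to the two sides. Serves twice below: for the terms of a series and for its
  centred partial sums.\<close>

lemma sum_lessThan_periodic:
  fixes f :: "nat \<Rightarrow> 'a::comm_monoid_add"
  assumes per: "\<And>k. f (k + p) = f k" and zero: "(\<Sum>k<p. f k) = 0"
  shows "(\<Sum>k<n + p. f k) = (\<Sum>k<n. f k)"
proof (induction n)
  case 0
  then show ?case using zero by simp
next
  case (Suc n)
  then show ?case using per[of n] by simp
qed

lemma periodic_eq_mod:
  fixes f :: "nat \<Rightarrow> 'a"
  assumes per: "\<And>k. f (k + p) = f k"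
  shows "f n = f (n mod p)"
proof -
  have "f (m + q * p) = f m" for m q
  proof (induction q)
    case (Suc q)
    then show ?case using per[of "m + q * p"] by (simp add: ac_simps)
  qed simp
  from this[of "n mod p" "n div p"] show ?thesis by simp
qed

text \<open>Only the values on \<open>{..<p}\<close> occur, so the range is finite.\<close>

lemma periodic_imp_Bseq:
  fixes f :: "nat \<Rightarrow> 'a::real_normed_vector"
  assumes "p > 0" and per: "\<And>k. f (k + p) = f k"
  shows "Bseq f"
proof -
  have "range f \<subseteq> f ` {..<p}"
  proof
    fix y assume "y \<in> range f"
    then obtain n where "y = f n" by blast
    then have "y = f (n mod p)" using periodic_eq_mod[of f p n] per by simp
    then show "y \<in> f ` {..<p}" using \<open>p > 0\<close> by auto
  qed
  then have "finite (range f)" by (rule finite_subset) simp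
  then show ?thesis using finite_imp_bounded Bseq_eq_bounded by blast
qed

lemma cesaro_sums_periodic:
  assumes "p > 0" and per: "\<And>k. a (k + p) = a k" and zero: "(\<Sum>k<p. a k) = 0"
  shows "cesaro_sums a (ereal (cesaro_mean a p))"
proof -
  define c where "c = cesaro_mean a p"
  \<comment> \<open>For n > 0 the mean differs from its claimed limit \<open>c\<close> by
    \<open>D n / n\<close>, so boundedness of \<open>D\<close> suffices. Centring by the average
    over one period makes \<open>D\<close> periodic.\<close>
  define D where "D n = (\<Sum>k<n. partial_sum a k - c)" for n
  have "partial_sum a (k + p) = partial_sum a k" for k
    using sum_lessThan_periodic[of a p "Suc k", OF per zero]
    by (simp add: partial_sum_def lessThan_Suc_atMost)
  moreover have "(\<Sum>k<p. partial_sum a k - c) = 0"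
    using \<open>p > 0\<close> by (simp add: sum_subtractf c_def cesaro_mean_def)
  ultimately have "D (n + p) = D n" for n
    unfolding D_def by (intro sum_lessThan_periodic) auto
  then have "Bseq D" using \<open>p > 0\<close> by (rule periodic_imp_Bseq[rotated])
  then have "(\<lambda>n. D n * (1 / real n)) \<longlonglongrightarrow> 0"
    using lim_1_over_n[where ?'a = real] unfolding tendsto_Zfun_iff diff_0_right
    by (rule bounded_bilinear.Bfun_prod_Zfun[OF bounded_bilinear_mult])
  from tendsto_add[OF this tendsto_const[of c]]
  have "(\<lambda>n. D n * (1 / real n) + c) \<longlonglongrightarrow> c" by simp
  \<comment> \<open>Only eventually: at n = 0 the left side is \<open>c\<close> and the right side
    0.\<close>
  moreover have "\<forall>\<^sub>F n in sequentially. D n * (1 / real n) + c = cesaro_mean a n"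
    using eventually_gt_at_top[of 0]
    by eventually_elim (simp add: D_def cesaro_mean_def sum_subtractf field_simps)
  ultimately have "cesaro_mean a \<longlonglongrightarrow> c"
    by (blast intro: Lim_transform_eventually)
  then show ?thesis unfolding cesaro_sums_def c_def by simp
qed

lemma cesaro_sums_unique: "cesaro_sums a s \<Longrightarrow> cesaro_sums a t \<Longrightarrow> s = t"
  unfolding cesaro_sums_def by (rule LIMSEQ_unique)

lemma group_pairs_UNIV_grandi: "group_pairs UNIV (\<lambda>n. (- 1) ^ n) m = 0"
proof -
  have starts: "group_starts UNIV = {i. even i}"
    unfolding group_starts_def by (auto, metis oddE Suc_eq_plus1)
  \<comment> \<open>Infinitude ensures that every value of \<open>enumerate\<close> lies in the
    set.\<close>
  have "infinite {i::nat. even i}"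
    unfolding infinite_nat_iff_unbounded_le
  proof
    fix m :: nat
    show "\<exists>n\<ge>m. n \<in> {i. even i}" by (rule exI[of _ "2 * m"]) simp
  qed
  then have "even (enumerate (group_starts UNIV) m)"
    using enumerate_in_set[of "{i::nat. even i}" m] by (simp add: starts)
  then show ?thesis by (simp add: group_pairs_def Let_def)
qed

lemma swap_pairs_UNIV_grandi: "swap_pairs UNIV (\<lambda>n. (- 1) ^ n) m = - ((- 1) ^ m)"
  by (cases "even m") (auto simp: swap_pairs_def)

text \<open>Half of \<open>n\<close>, rounded up, counts the even numbers below \<open>n\<close>.
  Hence 2k moves to 3k and 2k + 1 to 3k + 2.\<close>

lemma diluted_index_evens: "diluted_index {j. even j} n = n + (n + 1) div 2"
proof -
  have "card {j::nat. even j \<and> j < n} = (n + 1) div 2"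
  proof (induction n)
    case (Suc n)
    have "{j. even j \<and> j < Suc n} =
        (if even n then insert n {j. even j \<and> j < n} else {j. even j \<and> j < n})"
      by (auto simp: less_Suc_eq)
    then show ?case using Suc by auto
  qed simp
  then show ?thesis by (simp add: diluted_index_def)
qed

lemma dilute_evens_grandi:
  "dilute {j. even j} (\<lambda>n. (- 1) ^ n) m = (if m mod 3 = 0 then 1 else if m mod 3 = 1 then 0 else - 1)"
proof -
  let ?d = "diluted_index {j. even j}"
  let ?a = "\<lambda>n::nat. (- 1 :: real) ^ n"
  \<comment> \<open>Injectivity lets \<open>inv\<close> in \<open>dilute\<close> recover the
    original index.\<close>
  have "inj ?d" by (rule strict_mono_imp_inj_on) (auto simp: strict_mono_Suc_iff diluted_index_evens)
  then have hit: "dilute {j. even j} ?a (?d n) = ?a n" for n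
    by (simp add: dilute_def)
  have "(\<exists>k. m = 3 * k) \<or> (\<exists>k. m = 3 * k + 1) \<or> (\<exists>k. m = 3 * k + 2)" by presburger
  then consider k where "m = 3 * k" | k where "m = 3 * k + 1" | k where "m = 3 * k + 2"
    by blast
  then show ?thesis
  proof cases
    case 1
    then show ?thesis using hit[of "2 * k"] by (simp add: diluted_index_evens)
  next
    case 2
    \<comment> \<open>Both parities of \<open>n\<close> miss the residue 1 modulo 3, so these places
      hold the inserted zeros.\<close>
    have "?d n \<noteq> m" for n
    proof (cases "even n")
      case True
      then obtain j where "n = 2 * j" by blast
      then show ?thesis unfolding 2 diluted_index_evens by simp presburger
    next
      case False
      then obtain j where "n = 2 * j + 1" by (rule oddE)
      then show ?thesis unfolding 2 diluted_index_evens by simp presburger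
    qed
    then have "m \<notin> range ?d" by blast
    then show ?thesis using 2 by (simp add: dilute_def mod_simps)
  next
    case 3
    then have "m mod 3 = 2" by presburger
    with 3 show ?thesis using hit[of "2 * k + 1"] by (simp add: diluted_index_evens)
  qed
qed

theorem lemma1:
  "\<not> associativity_property cesaro_sums \<and>
   \<not> commutativity_property cesaro_sums \<and>
   \<not> dilution_property cesaro_sums"
proof -
  let ?a = "\<lambda>n::nat. (- 1 :: real) ^ n"
  note mean_simps = cesaro_mean_def partial_sum_def lessThan_nat_numeral
    atMost_nat_numeral lessThan_Suc atMost_Suc
  have grandi: "cesaro_sums ?a (ereal (1 / 2))"
    using cesaro_sums_periodic[of 2 ?a] by (simp add: mean_simps)
  have "cesaro_sums (group_pairs UNIV ?a) (ereal 0)"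
    using cesaro_sums_periodic[of 1 "group_pairs UNIV ?a"]
    by (simp add: mean_simps group_pairs_UNIV_grandi)
  then have assoc: "\<not> cesaro_sums (group_pairs UNIV ?a) (ereal (1 / 2))"
    by (auto dest: cesaro_sums_unique)
  have "cesaro_sums (swap_pairs UNIV ?a) (ereal (- 1 / 2))"
    using cesaro_sums_periodic[of 2 "swap_pairs UNIV ?a"]
    by (simp add: mean_simps swap_pairs_UNIV_grandi)
  then have comm: "\<not> cesaro_sums (swap_pairs UNIV ?a) (ereal (1 / 2))"
    by (auto dest: cesaro_sums_unique)
  \<comment> \<open>The partial sums over one period are 1, 1, 0.\<close>
  have "cesaro_sums (dilute {j. even j} ?a) (ereal (2 / 3))"
    using cesaro_sums_periodic[of 3 "dilute {j. even j} ?a"]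
    by (simp add: mean_simps dilute_evens_grandi)
  then have dil: "\<not> cesaro_sums (dilute {j. even j} ?a) (ereal (1 / 2))"
    by (auto dest: cesaro_sums_unique)
  show ?thesis
    unfolding associativity_property_def commutativity_property_def dilution_property_def
    using grandi assoc comm dil by blast
qed

end
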